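(* Let $(G,l,A,\sigma)$ be a labelled graph with multiplicity on $n$ vertices and let $1,k$ be two distinct vertices of $G$ with $\{1,k\}\notin E_G$. Suppose the collapse of $1$ and $k$ is singular. Then there are a (nonempty) finite number of matrices $C_{1\equiv k}$ such that $$(R_{l'}\,\mathcal{A}_G)\,C_{1\equiv k}=\mathcal{A}_{G_{1\equiv k}},$$ where $l'$ is the labeling of $G$ obtained from $l$ by giving the same label to the two edges of each collapsing pair, $R_{l'}$ is the corresponding relabeling matrix (so that $R_{l'}\mathcal{A}_{(G,l,A,\sigma)}=\mathcal{A}_{(G,l',A',\sigma)}$), and $C_{1\equiv k}$ is a matrix of the collapse, i.e. when the columns of $\mathcal{A}_G$ are ordered with those of the feasible variables first, $C_{1\equiv k}$ is the $2^{n-1}\times2^{n-2}$ matrix $\begin{pmatrix}\operatorname{id}\\0\end{pmatrix}$.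
   Context: Graphs are finite and simple, $G=(V_G;E_G)$ with $|V_G|=n$. Partitions. For a finite nonempty set $V$, $\Pi_V$ is the set of unordered pairs $A|B$ with $A\cup B=V$, $A\cap B=\emptyset$ (one of $A,B$ may be empty; $A|B=B|A$). $Cut_G(A|B)$ is the set of edges of $G$ with one endpoint in $A$ and the other in $B$. Labelled graphs with multiplicity. A labeling is a surjective map $l:E_G\to A$ onto a set $A$ of labels. A multiplicity map is a map $\sigma:E_G\to\mathbb{Z}\setminus\{0\}$. Then $(G,l,A,\sigma)$ is a labelled graph with multiplicity. The matrix $\mathcal{A}$. The toric map $\phi_{(G,l,A,\sigma)}$ sends the variable $r_p$ ($p\in\Pi_{V_G}$) to $\prod_{e\in Cut_G(p)}s_{l(e)}^{\sigma(e)}\prod_{e\in E_G\setminus Cut_G(p)}t_{l(e)}^{\sigma(e)}$ in variables $s_a,t_a$ ($a\in A$). $\mathcal{A}_G=\mathcal{A}_{(G,l,A,\sigma)}$ is the integer matrix with rows indexed first by $s_a$, then by $t_a$ ($a\in A$), and columns indexed by $\Pi_{V_G}$ (in some chosen order), the column of $p$ being the exponent vector of the image of $r_p$. Collapse. Let $\{1,k\}\notin E_G$. The collapsed graph $(G_{1\equiv k},l',A',\sigma')$ has vertex set $V_G\setminus\{k\}$; its edge set $E'$ is obtained from $E_G$ by replacing each edge $\{i,k\}$ by $\{i,1\}$, keeping only one copy of repeated edges. A collapsing pair is a pair of edges $\{1,i\},\{k,i\}$ both in $E_G$. The collapse is singular if $|E'|<|E_G|$, i.e. there is at least one collapsing pair.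 For $\{i,j\}\in E'$ with $1\notin\{i,j\}$, $\sigma'(\{i,j\})=\sigma(\{i,j\})$; for $\{1,j\}\in E'$, $\sigma'(\{1,j\})=\sigma(\{1,j\})+\sigma(\{k,j\})$, where $\sigma$ of a non-edge is read as $0$; $\sigma'$ is assumed to take nonzero values. The label set $A'$ is the quotient of $A$ by the equivalence relation generated by $l(\{k,i\})\sim l(\{1,i\})$ for all collapsing pairs; the relabeling $l'$ of $G$ sends an edge to the class of its $l$-label, and the labeling $l'$ of $G_{1\equiv k}$ sends an edge of $E'$ to the $l'$-label of any edge of $G$ from which it comes. $\mathcal{A}_{G_{1\equiv k}}$ is the matrix of $(G_{1\equiv k},l',A',\sigma')$. Relabeling matrix. $R_{l'}=\begin{pmatrix}B_{l'}&0\\0&B_{l'}\end{pmatrix}$, where $B_{l'}$ is the $|A'|\times|A|$ matrix with entry $1$ in position $(a',a)$ if $a'$ is the class of $a$, and $0$ otherwise. Feasibility. A partition $A|B\in\Pi_{V_G}$ is feasible if $1$ and $k$ lie both in $A$ or both in $B$; the variable $r_{A|B}$ is then feasible, otherwise non-feasible. For $p\in\Pi_{V_G\setminus\{k\}}$, $p_f\in\Pi_{V_G}$ is the feasible partition obtained by adding $k$ to the part of $p$ containing $1$. In the block form of $C_{1\equiv k}$, the feasible columns are ordered so that $p_f$ is in the position of $p$ in the chosen order of the columns of $\mathcal{A}_{G_{1\equiv k}}$. *)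

theory Defs
  imports
    "Jordan_Normal_Form.Matrix"
    "HOL-Library.Poly_Mapping"
    "HOL-Combinatorics.Permutations"
begin

text \<open>Edges are two-element sets of vertices. Labelings and multiplicity maps are total
  functions of which only the values on the edge set matter. The two vertices that are
  collapsed (\<open>1\<close> and \<open>k\<close> in the informal text) are called \<open>u\<close> and \<open>k\<close>; \<open>k\<close> is the one removed.\<close>

definition simple_graph :: "'v set \<Rightarrow> 'v set set \<Rightarrow> bool" where
  "simple_graph V E \<longleftrightarrow> finite V \<and> V \<noteq> {} \<and> (\<forall>e\<in>E. e \<subseteq> V \<and> card e = 2)"

definition labelled_graph ::
  "'v set \<Rightarrow> 'v set set \<Rightarrow> ('v set \<Rightarrow> 'a) \<Rightarrow> 'a set \<Rightarrow> ('v set \<Rightarrow> int) \<Rightarrow> bool" where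
  "labelled_graph V E l A \<sigma> \<longleftrightarrow> simple_graph V E \<and> l ` E = A \<and> (\<forall>e\<in>E. \<sigma> e \<noteq> 0)"

text \<open>The unordered pair \<open>X|Y\<close> is the set \<open>{X, Y}\<close>; one of the parts may be empty.\<close>

definition partitions :: "'v set \<Rightarrow> 'v set set set" where
  "partitions V = {{X, Y} | X Y. X \<union> Y = V \<and> X \<inter> Y = {}}"

definition cut :: "'v set set \<Rightarrow> 'v set set \<Rightarrow> 'v set set" where
  "cut E p = {e \<in> E. \<exists>X Y x y. p = {X, Y} \<and> x \<in> X \<and> y \<in> Y \<and> e = {x, y}}"

datatype 'a var = S 'a | T 'a

text \<open>The image of \<open>r\<^sub>p\<close> under the toric map. A Laurent monomial in the variables \<open>S a\<close>, \<open>T a\<close>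
  is represented by its exponent vector, so the product of monomials is a sum here, and
  \<open>single x m\<close> stands for the power of the variable \<open>x\<close> with exponent \<open>m\<close>.\<close>

definition toric_image ::
  "'v set set \<Rightarrow> ('v set \<Rightarrow> 'a) \<Rightarrow> ('v set \<Rightarrow> int) \<Rightarrow> 'v set set \<Rightarrow> 'a var \<Rightarrow>\<^sub>0 int" where
  "toric_image E l \<sigma> p =
     (\<Sum>e\<in>cut E p. Poly_Mapping.single (S (l e)) (\<sigma> e)) +
     (\<Sum>e\<in>E - cut E p. Poly_Mapping.single (T (l e)) (\<sigma> e))"

text \<open>Orders of rows and columns are given by lists without repetitions.\<close>

definition enumerates :: "'b list \<Rightarrow> 'b set \<Rightarrow> bool" where
  "enumerates xs X \<longleftrightarrow> distinct xs \<and> set xs = X"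

definition toric_matrix ::
  "'v set set \<Rightarrow> ('v set \<Rightarrow> 'a) \<Rightarrow> ('v set \<Rightarrow> int) \<Rightarrow> 'a list \<Rightarrow> 'v set set list \<Rightarrow> int mat" where
  "toric_matrix E l \<sigma> as ps =
     (let xs = map S as @ map T as in
      mat (length xs) (length ps) (\<lambda>(i, j). Poly_Mapping.lookup (toric_image E l \<sigma> (ps ! j)) (xs ! i)))"

definition collapse_edge :: "'v \<Rightarrow> 'v \<Rightarrow> 'v set \<Rightarrow> 'v set" where
  "collapse_edge u k e = (if k \<in> e then insert u (e - {k}) else e)"

definition collapse_edges :: "'v set set \<Rightarrow> 'v \<Rightarrow> 'v \<Rightarrow> 'v set set" where
  "collapse_edges E u k = collapse_edge u k ` E"

definition singular_collapse :: "'v set set \<Rightarrow> 'v \<Rightarrow> 'v \<Rightarrow> bool" where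
  "singular_collapse E u k \<longleftrightarrow> card (collapse_edges E u k) < card E"

definition collapse_mult ::
  "'v set set \<Rightarrow> ('v set \<Rightarrow> int) \<Rightarrow> 'v \<Rightarrow> 'v \<Rightarrow> 'v set \<Rightarrow> int" where
  "collapse_mult E \<sigma> u k e =
     (let \<sigma>0 = (\<lambda>e. if e \<in> E then \<sigma> e else 0) in
      if u \<in> e then \<sigma>0 e + \<sigma>0 (insert k (e - {u})) else \<sigma> e)"

definition label_equiv ::
  "'v set set \<Rightarrow> ('v set \<Rightarrow> 'a) \<Rightarrow> 'a set \<Rightarrow> 'v \<Rightarrow> 'v \<Rightarrow> ('a \<times> 'a) set" where
  "label_equiv E l A u k =
     {(a, b). a \<in> A \<and> b \<in> A \<and>
        equivclp (\<lambda>c d. \<exists>i. {u, i} \<in> E \<and> {k, i} \<in> E \<and> c = l {k, i} \<and> d = l {u, i}) a b}"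

definition label_class ::
  "'v set set \<Rightarrow> ('v set \<Rightarrow> 'a) \<Rightarrow> 'a set \<Rightarrow> 'v \<Rightarrow> 'v \<Rightarrow> 'a \<Rightarrow> 'a set" where
  "label_class E l A u k a = label_equiv E l A u k `` {a}"

definition collapse_labels ::
  "'v set set \<Rightarrow> ('v set \<Rightarrow> 'a) \<Rightarrow> 'a set \<Rightarrow> 'v \<Rightarrow> 'v \<Rightarrow> 'a set set" where
  "collapse_labels E l A u k = A // label_equiv E l A u k"

definition relabeling ::
  "'v set set \<Rightarrow> ('v set \<Rightarrow> 'a) \<Rightarrow> 'a set \<Rightarrow> 'v \<Rightarrow> 'v \<Rightarrow> 'v set \<Rightarrow> 'a set" where
  "relabeling E l A u k e = label_class E l A u k (l e)"

text \<open>The label of an edge of the collapsed graph is the common new label of all edges of \<open>G\<close>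
  from which it comes.\<close>

definition collapse_labeling ::
  "'v set set \<Rightarrow> ('v set \<Rightarrow> 'a) \<Rightarrow> 'a set \<Rightarrow> 'v \<Rightarrow> 'v \<Rightarrow> 'v set \<Rightarrow> 'a set" where
  "collapse_labeling E l A u k e' =
     (THE c. \<exists>e\<in>E. collapse_edge u k e = e' \<and> c = relabeling E l A u k e)"

definition relabel_block ::
  "'v set set \<Rightarrow> ('v set \<Rightarrow> 'a) \<Rightarrow> 'a set \<Rightarrow> 'v \<Rightarrow> 'v \<Rightarrow> 'a list \<Rightarrow> 'a set list \<Rightarrow> int mat" where
  "relabel_block E l A u k as as' =
     mat (length as') (length as)
       (\<lambda>(i, j). if as' ! i = label_class E l A u k (as ! j) then 1 else 0)"

definition relabel_matrix ::
  "'v set set \<Rightarrow> ('v set \<Rightarrow> 'a) \<Rightarrow> 'a set \<Rightarrow> 'v \<Rightarrow> 'v \<Rightarrow> 'a list \<Rightarrow> 'a set list \<Rightarrow> int mat" where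
  "relabel_matrix E l A u k as as' =
     (let B = relabel_block E l A u k as as'; Z = 0\<^sub>m (length as') (length as)
      in four_block_mat B Z Z B)"

definition feasible :: "'v \<Rightarrow> 'v \<Rightarrow> 'v set set \<Rightarrow> bool" where
  "feasible u k p \<longleftrightarrow> (\<exists>X\<in>p. u \<in> X \<and> k \<in> X)"

definition feasible_ext :: "'v \<Rightarrow> 'v \<Rightarrow> 'v set set \<Rightarrow> 'v set set" where
  "feasible_ext u k p = (\<lambda>X. if u \<in> X then insert k X else X) ` p"

text \<open>Matrices of the collapse, for given orders \<open>ps\<close>, \<open>qs\<close> of the partitions of \<open>V\<close> and of
  \<open>V - {k}\<close>. The permutation \<open>\<pi>\<close> puts \<open>ps\<close> into an order with the feasible partitions first and in
  the positions prescribed by \<open>qs\<close>; the rows of \<open>C\<close>, indexed by \<open>ps\<close>, are reordered accordingly.\<close>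

definition collapse_matrices ::
  "'v set \<Rightarrow> 'v \<Rightarrow> 'v \<Rightarrow> 'v set set list \<Rightarrow> 'v set set list \<Rightarrow> int mat set" where
  "collapse_matrices V u k ps qs =
     (let r = 2 ^ (card V - 1); c = 2 ^ (card V - 2) in
      {C \<in> carrier_mat r c. \<exists>\<pi>. \<pi> permutes {..<r} \<and>
         (\<forall>i<r. feasible u k (ps ! \<pi> i) \<longleftrightarrow> i < c) \<and>
         (\<forall>i<c. ps ! \<pi> i = feasible_ext u k (qs ! i)) \<and>
         mat r c (\<lambda>(i, j). C $$ (\<pi> i, j)) = 1\<^sub>m c @\<^sub>r 0\<^sub>m (r - c) c})"

end

theory Submission
  imports Defs
begin

text \<open>On a feasible partition, an edge of the graph is cut if and only if its image in the collapsed
  graph is cut, and the multiplicity of a collapsed edge is the sum of the multiplicities over its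
  fibre, on which the new labels are constant. So the column of \<open>p\<close> for the collapsed graph is the
  column of its feasible extension for the relabelled graph, and every matrix of the collapse selects
  exactly these columns. Such matrices have entries in \<open>{0, 1}\<close>, so there are only finitely many.\<close>

section \<open>Finiteness of the edge set and the number of partitions\<close>

lemma simple_graph_finite_edges:
  assumes "simple_graph V E"
  shows "finite E"
proof (rule finite_subset)
  show "E \<subseteq> Pow V" using assms by (auto simp: simple_graph_def)
  show "finite (Pow V)" using assms by (simp add: simple_graph_def)
qed

text \<open>The part avoiding a fixed vertex \<open>u\<close> serves as canonical representative, so
  that unordered pairs are handled as subsets of \<open>V - {u}\<close>. All later arguments about
  partitions go through this parametrization.\<close>

lemma partitions_eq_image:
  assumes "u \<in> V"
  shows "partitions V = (\<lambda>X. {X, V - X}) ` Pow (V - {u})" (is "_ = ?R")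
proof
  show "?R \<subseteq> partitions V" by (auto simp: partitions_def)
  show "partitions V \<subseteq> ?R"
  proof
    fix p assume "p \<in> partitions V"
    then obtain X Y where p: "p = {X, Y}" "X \<union> Y = V" "X \<inter> Y = {}"
      by (auto simp: partitions_def)
    show "p \<in> ?R"
    proof (cases "u \<in> X")
      case True
      then have "Y \<in> Pow (V - {u})" "p = {Y, V - Y}" using p by auto
      then show ?thesis by blast
    next
      case False
      then have "X \<in> Pow (V - {u})" "p = {X, V - X}" using p by auto
      then show ?thesis by blast
    qed
  qed
qed

text \<open>Equal pairs could otherwise arise only from complementary sets, but of two complementary
  sets exactly one contains \<open>u\<close>.\<close>

lemma partition_inj_on:
  assumes "u \<in> V"
  shows "inj_on (\<lambda>X. {X, V - X}) (Pow (V - {u}))"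
  using assms by (intro inj_onI) (auto simp: doubleton_eq_iff)

lemma card_partitions:
  assumes "finite V" "V \<noteq> {}"
  shows "card (partitions V) = 2 ^ (card V - 1)"
proof -
  obtain u where u: "u \<in> V" using assms by blast
  then show ?thesis
    using assms
    by (simp add: partitions_eq_image[OF u] card_image[OF partition_inj_on[OF u]] card_Pow)
qed

lemma card_partitions_remove:
  assumes "finite V" "u \<in> V" "k \<in> V" "u \<noteq> k"
  shows "card (partitions (V - {k})) = 2 ^ (card V - 2)"
proof -
  have "V - {k} \<noteq> {}" "card (V - {k}) - 1 = card V - 2" using assms by auto
  then show ?thesis using card_partitions[of "V - {k}"] assms(1) by simp
qed

section \<open>Cuts and feasible partitions\<close>

lemma mem_cut_partition:
  assumes "e \<subseteq> V" "card e = 2" "X \<subseteq> V"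
  shows "e \<in> cut E {X, V - X} \<longleftrightarrow> e \<in> E \<and> e \<inter> X \<noteq> {} \<and> \<not> e \<subseteq> X"
proof -
  obtain a b where e: "e = {a, b}" "a \<noteq> b"
    using assms(2) by (auto simp: card_2_iff)
  \<comment> \<open>The definition of \<open>cut\<close> allows the parts to be named in either
    order; since \<open>{x, y} = {y, x}\<close>, the end in \<open>X\<close> may be listed
    first.\<close>
  have "e \<in> cut E {X, V - X} \<longleftrightarrow> e \<in> E \<and> (\<exists>x\<in>X. \<exists>y\<in>V - X. e = {x, y})"
    unfolding cut_def by (auto simp: doubleton_eq_iff)
  also have "(\<exists>x\<in>X. \<exists>y\<in>V - X. e = {x, y}) \<longleftrightarrow> e \<inter> X \<noteq> {} \<and> \<not> e \<subseteq> X"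
    using e assms(1) by (auto simp: doubleton_eq_iff)
  finally show ?thesis .
qed

text \<open>The representative \<open>X\<close> avoids \<open>u\<close>, so \<open>k\<close> joins
  the other part and \<open>X\<close> itself is unchanged.\<close>

lemma feasible_ext_partition:
  assumes "u \<in> V" "k \<in> V" "u \<noteq> k" "X \<subseteq> V - {k} - {u}"
  shows "feasible_ext u k {X, V - {k} - X} = {X, V - X}"
proof -
  have "u \<notin> X" "u \<in> V - {k} - X" "insert k (V - {k} - X) = V - X" using assms by auto
  then show ?thesis by (simp add: feasible_ext_def)
qed

text \<open>Here \<open>u\<close> lies in \<open>V - X\<close>, so that is the only part that can
  contain both vertices.\<close>

lemma feasible_partition:
  assumes "u \<in> V" "k \<in> V" "X \<subseteq> V - {u}"
  shows "feasible u k {X, V - X} \<longleftrightarrow> k \<notin> X"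
  using assms by (auto simp: feasible_def)

text \<open>In terms of representatives avoiding \<open>u\<close>, both sides are parametrized by
  the subsets of \<open>V - {k} - {u}\<close>, and the extension acts on these as the
  identity.\<close>

lemma feasible_ext_bij_betw:
  assumes "u \<in> V" "k \<in> V" "u \<noteq> k"
  shows "bij_betw (feasible_ext u k) (partitions (V - {k})) {p \<in> partitions V. feasible u k p}"
proof (rule bij_betw_imageI)
  have u: "u \<in> V - {k}" using assms by simp
  note ext = feasible_ext_partition[OF assms]
  have inj: "inj_on (\<lambda>X. {X, V - X}) (Pow (V - {k} - {u}))"
    by (rule inj_on_subset[OF partition_inj_on[OF assms(1)]]) auto
  show "inj_on (feasible_ext u k) (partitions (V - {k}))"
    using inj unfolding partitions_eq_image[OF u] inj_on_def by (auto simp: ext subset_eq)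
  have "feasible_ext u k ` partitions (V - {k}) = (\<lambda>X. {X, V - X}) ` Pow (V - {k} - {u})"
    unfolding partitions_eq_image[OF u] image_image by (rule image_cong) (auto simp: ext)
  also have "\<dots> = (\<lambda>X. {X, V - X}) ` {X \<in> Pow (V - {u}). k \<notin> X}"
    by (rule arg_cong[where f = "image _"]) auto
  also have "\<dots> = {p \<in> partitions V. feasible u k p}"
    unfolding partitions_eq_image[OF assms(1)] using feasible_partition[OF assms(1,2)] by auto
  finally show "feasible_ext u k ` partitions (V - {k}) = {p \<in> partitions V. feasible u k p}" .
qed

section \<open>Label classes\<close>

lemma equiv_label_equiv: "equiv A (label_equiv E l A u k)"
proof (rule equivI)
  show "refl_on A (label_equiv E l A u k)"
    by (auto simp: refl_on_def label_equiv_def)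
  show "sym (label_equiv E l A u k)"
    by (auto simp: sym_def label_equiv_def intro: equivclp_sym)
  show "trans (label_equiv E l A u k)"
    by (auto simp: trans_def label_equiv_def intro: equivclp_trans)
qed (auto simp: label_equiv_def)

text \<open>The two old labels form a generator of the equivalence relation, hence have the same
  class.\<close>

lemma relabeling_collapsing_pair:
  assumes "l ` E = A" "{u, i} \<in> E" "{k, i} \<in> E"
  shows "relabeling E l A u k {k, i} = relabeling E l A u k {u, i}"
  unfolding relabeling_def label_class_def
proof (rule equiv_class_eq[OF equiv_label_equiv])
  show "(l {k, i}, l {u, i}) \<in> label_equiv E l A u k"
    using assms by (auto simp: label_equiv_def intro!: r_into_equivclp)
qed

section \<open>The collapse map on edges and its fibres\<close>

lemma collapse_edge_subset:
  assumes "simple_graph V E" "u \<in> V" "u \<noteq> k" "e \<in> E"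
  shows "collapse_edge u k e \<subseteq> V - {k}"
  using assms by (auto simp: collapse_edge_def simple_graph_def)

lemma edge_containing:
  assumes "simple_graph V E" "e \<in> E" "k \<in> e"
  obtains i where "e = {k, i}" "i \<noteq> k"
proof -
  have "card e = 2" using assms by (simp add: simple_graph_def)
  then obtain a b where "e = {a, b}" "a \<noteq> b" by (auto simp: card_2_iff)
  then show ?thesis using assms(3) that by (cases "a = k") (auto simp: insert_commute)
qed

text \<open>A loop could arise only from the edge \<open>{u, k}\<close>, which is excluded.\<close>

lemma collapse_edge_card:
  assumes "simple_graph V E" "{u, k} \<notin> E" "e \<in> E"
  shows "card (collapse_edge u k e) = 2"
proof (cases "k \<in> e")
  case True
  then obtain i where e: "e = {k, i}" "i \<noteq> k" using assms edge_containing by metis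
  then have "i \<noteq> u" using assms by (auto simp: insert_commute)
  moreover have "collapse_edge u k e = {u, i}" using e by (auto simp: collapse_edge_def)
  ultimately show ?thesis by simp
next
  case False
  then show ?thesis using assms by (simp add: collapse_edge_def simple_graph_def)
qed

text \<open>Only collapsing pairs are identified: two edges through \<open>k\<close> with the same
  image share their other end and coincide, so \<open>e\<close> avoids \<open>k\<close> and is fixed
  by the collapse.\<close>

lemma collapse_edge_eqD:
  assumes "simple_graph V E" "u \<noteq> k" "{u, k} \<notin> E" "e \<in> E" "f \<in> E" "k \<in> f"
    "collapse_edge u k e = collapse_edge u k f" "e \<noteq> f"
  obtains i where "e = {u, i}" "f = {k, i}"
proof -
  obtain i where f: "f = {k, i}" "i \<noteq> k" using assms edge_containing by metis
  have iu: "i \<noteq> u" using f assms by (auto simp: insert_commute)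
  have cf: "collapse_edge u k f = {u, i}" using f by (auto simp: collapse_edge_def)
  have "k \<notin> e"
  proof
    assume "k \<in> e"
    then obtain j where e: "e = {k, j}" "j \<noteq> k" using assms edge_containing by metis
    then have "collapse_edge u k e = {u, j}" by (auto simp: collapse_edge_def)
    then have "j = i" using cf assms(7) iu by (auto simp: doubleton_eq_iff)
    then show False using e f assms(8) by simp
  qed
  then have "e = {u, i}" using cf assms(7) by (simp add: collapse_edge_def)
  then show ?thesis using f that by blast
qed

text \<open>Two distinct edges in a fibre form a collapsing pair. The cases differ only in which of
  the two edges passes through \<open>k\<close>.\<close>

lemma relabeling_eq_on_fibre:
  assumes "simple_graph V E" "l ` E = A" "u \<noteq> k" "{u, k} \<notin> E" "e \<in> E" "f \<in> E"
    "collapse_edge u k e = collapse_edge u k f"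
  shows "relabeling E l A u k e = relabeling E l A u k f"
proof (cases "e = f")
  case False
  have "k \<in> e \<or> k \<in> f" using False assms(7) by (auto simp: collapse_edge_def)
  then show ?thesis
  proof
    assume "k \<in> f"
    then obtain i where "e = {u, i}" "f = {k, i}"
      using collapse_edge_eqD[OF assms(1,3-6) _ assms(7) False] by blast
    then show ?thesis using relabeling_collapsing_pair[OF assms(2)] assms(5,6) by metis
  next
    assume "k \<in> e"
    then obtain i where "f = {u, i}" "e = {k, i}"
      using collapse_edge_eqD[OF assms(1,3,4,6,5) _ assms(7)[symmetric]] False by blast
    then show ?thesis using relabeling_collapsing_pair[OF assms(2)] assms(5,6) by metis
  qed
qed simp

text \<open>Constancy of the new label on fibres makes the definite description in
  \<open>collapse_labeling\<close> well defined.\<close>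

lemma collapse_labeling_collapse_edge:
  assumes "simple_graph V E" "l ` E = A" "u \<noteq> k" "{u, k} \<notin> E" "e \<in> E"
  shows "collapse_labeling E l A u k (collapse_edge u k e) = relabeling E l A u k e"
  unfolding collapse_labeling_def
proof (rule the_equality)
  show "\<exists>f\<in>E. collapse_edge u k f = collapse_edge u k e \<and>
      relabeling E l A u k e = relabeling E l A u k f"
    using assms(5) by blast
next
  fix c assume "\<exists>f\<in>E. collapse_edge u k f = collapse_edge u k e \<and> c = relabeling E l A u k f"
  then show "c = relabeling E l A u k e"
    using relabeling_eq_on_fibre[OF assms(1-4)] assms(5) by blast
qed

text \<open>This form treats simple edges and collapsing pairs uniformly and lets multiplicities be
  regrouped along the collapse map.\<close>

lemma collapse_mult_eq_sum_fibre:
  assumes "simple_graph V E" "u \<noteq> k" "{u, k} \<notin> E" "e' \<in> collapse_edges E u k"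
  shows "collapse_mult E \<sigma> u k e' = (\<Sum>e | e \<in> E \<and> collapse_edge u k e = e'. \<sigma> e)"
proof (cases "u \<in> e'")
  case False
  then have "e' \<in> E" "k \<notin> e'" using assms(2,4)
    by (auto simp: collapse_edges_def collapse_edge_def split: if_splits)
  then have "{e. e \<in> E \<and> collapse_edge u k e = e'} = {e'}"
    using False by (auto simp: collapse_edge_def split: if_splits)
  then show ?thesis using False by (simp add: collapse_mult_def)
next
  case True
  let ?f = "insert k (e' - {u})"
  obtain e where e: "e \<in> E" "e' = collapse_edge u k e"
    using assms(4) by (auto simp: collapse_edges_def)
  have k: "k \<notin> e'" using e assms(2) by (auto simp: collapse_edge_def split: if_splits)
  \<comment> \<open>Intersecting with \<open>E\<close> matches the convention that a non-edge has
    multiplicity 0.\<close>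
  have "{e. e \<in> E \<and> collapse_edge u k e = e'} = {e', ?f} \<inter> E" (is "?L = ?R")
  proof
    show "?R \<subseteq> ?L" using True k by (auto simp: collapse_edge_def insert_absorb)
    show "?L \<subseteq> ?R"
    proof
      fix f assume "f \<in> ?L"
      then have f: "f \<in> E" "collapse_edge u k f = e'" by auto
      show "f \<in> ?R"
      proof (cases "k \<in> f")
        case k_in: True
        then obtain i where i: "f = {k, i}" "i \<noteq> k" using assms f edge_containing by metis
        then have "i \<noteq> u" using assms f by (auto simp: insert_commute)
        then show ?thesis using i f by (auto simp: collapse_edge_def)
      qed (use f in \<open>simp add: collapse_edge_def\<close>)
    qed
  qed
  \<comment> \<open>Distinctness of the two candidates makes the sum over the set agree with the sum
    of the two terms.\<close>
  moreover have "e' \<noteq> ?f" using k by blast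
  ultimately show ?thesis using True
    by (simp add: collapse_mult_def Let_def Int_insert_left)
qed

section \<open>Exponent vectors and their behaviour under collapse\<close>

lemma lookup_toric_image_S:
  assumes "finite E"
  shows "Poly_Mapping.lookup (toric_image E l \<sigma> p) (S a) = (\<Sum>e | e \<in> cut E p \<and> l e = a. \<sigma> e)"
proof -
  have "finite (cut E p)" using assms by (simp add: cut_def)
  then show ?thesis
    by (simp add: toric_image_def lookup_add lookup_sum lookup_single when_def
        sum.If_cases Int_def)
qed

lemma lookup_toric_image_T:
  assumes "finite E"
  shows "Poly_Mapping.lookup (toric_image E l \<sigma> p) (T a) = (\<Sum>e | e \<in> E - cut E p \<and> l e = a. \<sigma> e)"
  using assms by (simp add: toric_image_def lookup_add lookup_sum lookup_single when_def
        sum.If_cases Int_def)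

text \<open>This is the identity of single columns. The edges contributing to a given exponent
  correspond along the collapse map, and their multiplicities add up over its fibres.\<close>

lemma toric_image_feasible_ext:
  assumes "simple_graph V E" "l ` E = A" "u \<in> V" "k \<in> V" "u \<noteq> k" "{u, k} \<notin> E"
    "p \<in> partitions (V - {k})"
  shows "toric_image (collapse_edges E u k) (collapse_labeling E l A u k) (collapse_mult E \<sigma> u k) p =
    toric_image E (relabeling E l A u k) \<sigma> (feasible_ext u k p)" (is "toric_image ?E' ?l' ?\<sigma>' p = ?rhs")
proof -
  have finE: "finite E" using assms(1) by (rule simple_graph_finite_edges)
  then have finE': "finite ?E'" by (simp add: collapse_edges_def)
  have u: "u \<in> V - {k}" using assms by simp
  obtain X where X: "X \<subseteq> V - {k} - {u}" "p = {X, V - {k} - X}"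
    using assms(7) unfolding partitions_eq_image[OF u] by auto
  have ext: "feasible_ext u k p = {X, V - X}"
    using feasible_ext_partition[OF assms(3-5) X(1)] X(2) by simp
  \<comment> \<open>Since \<open>X\<close> avoids both \<open>u\<close> and \<open>k\<close>,
    replacing \<open>k\<close> by \<open>u\<close> in an edge changes neither whether it meets
    \<open>X\<close> nor whether it lies inside \<open>X\<close>.\<close>
  have cut_iff: "collapse_edge u k e \<in> cut ?E' p \<longleftrightarrow> e \<in> cut E (feasible_ext u k p)"
    if "e \<in> E" for e
  proof -
    have "collapse_edge u k e \<in> cut ?E' p \<longleftrightarrow>
        collapse_edge u k e \<inter> X \<noteq> {} \<and> \<not> collapse_edge u k e \<subseteq> X"
      using that X assms mem_cut_partition[OF collapse_edge_subset[of V E u k e]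
          collapse_edge_card[of V E u k e], of X ?E']
      by (auto simp: collapse_edges_def)
    also have "\<dots> \<longleftrightarrow> e \<inter> X \<noteq> {} \<and> \<not> e \<subseteq> X"
      using X(1) by (auto simp: collapse_edge_def)
    also have "\<dots> \<longleftrightarrow> e \<in> cut E (feasible_ext u k p)"
      using that X assms(1) mem_cut_partition[of e V X E] unfolding ext simple_graph_def by blast
    finally show ?thesis .
  qed
  \<comment> \<open>Arbitrary corresponding edge sets are allowed, so that one argument serves the
    cut edges (variables \<open>S\<close>) and the uncut edges (variables \<open>T\<close>).\<close>
  have regroup: "(\<Sum>e' | e' \<in> F' \<and> ?l' e' = c. ?\<sigma>' e') =
      (\<Sum>e | e \<in> F \<and> relabeling E l A u k e = c. \<sigma> e)"
    if "F' \<subseteq> ?E'" "F \<subseteq> E" and iff: "\<And>e. e \<in> E \<Longrightarrow> collapse_edge u k e \<in> F' \<longleftrightarrow> e \<in> F" for F F' c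
  proof -
    let ?H' = "{e'. e' \<in> F' \<and> ?l' e' = c}" and ?H = "{e. e \<in> F \<and> relabeling E l A u k e = c}"
    have lab: "?l' (collapse_edge u k e) = relabeling E l A u k e" if "e \<in> E" for e
      using collapse_labeling_collapse_edge assms(1,2,5,6) that by metis
    have H: "collapse_edge u k e \<in> ?H' \<longleftrightarrow> e \<in> ?H" if "e \<in> E" for e
      using that iff lab by auto
    have "(\<Sum>e'\<in>?H'. ?\<sigma>' e') = (\<Sum>e'\<in>?H'. \<Sum>e | e \<in> ?H \<and> collapse_edge u k e = e'. \<sigma> e)"
    proof (rule sum.cong)
      fix e' assume e': "e' \<in> ?H'"
      then have "?\<sigma>' e' = (\<Sum>e | e \<in> E \<and> collapse_edge u k e = e'. \<sigma> e)"
        using collapse_mult_eq_sum_fibre[OF assms(1,5,6)] that(1) by blast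
      \<comment> \<open>Membership in \<open>?H\<close> depends only on the image of an edge, so
        \<open>?H\<close> contains every fibre over \<open>?H'\<close> entirely.\<close>
      also have "{e. e \<in> E \<and> collapse_edge u k e = e'} = {e. e \<in> ?H \<and> collapse_edge u k e = e'}"
        using H e' that(2) by blast
      finally show "?\<sigma>' e' = (\<Sum>e | e \<in> ?H \<and> collapse_edge u k e = e'. \<sigma> e)" .
    qed simp
    also have "\<dots> = (\<Sum>e\<in>?H. \<sigma> e)"
    proof (rule sum.group)
      show "finite ?H" using finE that(2) by (auto intro: finite_subset)
      show "finite ?H'" using finE' that(1) by (auto intro: finite_subset)
      show "collapse_edge u k ` ?H \<subseteq> ?H'" using H that(2) by blast
    qed
    finally show ?thesis .
  qed
  show ?thesis
  proof (rule poly_mapping_eqI)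
    fix v
    show "Poly_Mapping.lookup (toric_image ?E' ?l' ?\<sigma>' p) v = Poly_Mapping.lookup ?rhs v"
    proof (cases v)
      case (S c)
      show ?thesis unfolding S lookup_toric_image_S[OF finE] lookup_toric_image_S[OF finE']
        by (rule regroup) (use cut_iff in \<open>auto simp: cut_def\<close>)
    next
      case (T c)
      have "collapse_edge u k e \<in> ?E' - cut ?E' p \<longleftrightarrow> e \<in> E - cut E (feasible_ext u k p)"
        if "e \<in> E" for e
        using cut_iff[OF that] that by (auto simp: collapse_edges_def)
      then show ?thesis unfolding T lookup_toric_image_T[OF finE] lookup_toric_image_T[OF finE']
        by (intro regroup) auto
    qed
  qed
qed

section \<open>The relabeling matrix\<close>

lemma sum_nth_distinct:
  assumes "distinct xs"
  shows "(\<Sum>j<length xs. f (xs ! j)) = sum f (set xs)"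
  using sum.reindex_bij_betw[OF bij_betw_nth[OF assms refl refl]] .

text \<open>This is one row of the block \<open>B\<close> applied to one half of a column, with
  \<open>g\<close> as the class map: the 0/1 coefficients select the old labels in class
  \<open>c\<close>, and the selected edges are grouped by old label.\<close>

lemma sum_label_fibres:
  fixes \<sigma> :: "'e \<Rightarrow> int"
  assumes "enumerates as A" "l ` F \<subseteq> A" "finite F"
  shows "(\<Sum>j<length as. (if c = g (as ! j) then 1 else 0) * (\<Sum>e | e \<in> F \<and> l e = as ! j. \<sigma> e)) =
    (\<Sum>e | e \<in> F \<and> g (l e) = c. \<sigma> e)"
proof -
  have finA: "finite A" using assms(1) by (auto simp: enumerates_def)
  have "(\<Sum>j<length as. (if c = g (as ! j) then 1 else 0) * (\<Sum>e | e \<in> F \<and> l e = as ! j. \<sigma> e)) =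
      (\<Sum>a\<in>A. (if c = g a then 1 else 0) * (\<Sum>e | e \<in> F \<and> l e = a. \<sigma> e))"
    using sum_nth_distinct[of as "\<lambda>a. (if c = g a then 1 else 0) * (\<Sum>e | e \<in> F \<and> l e = a. \<sigma> e)"]
      assms(1) by (simp add: enumerates_def)
  also have "\<dots> = (\<Sum>a\<in>A. \<Sum>e | e \<in> {e \<in> F. g (l e) = c} \<and> l e = a. \<sigma> e)"
  proof (rule sum.cong[OF refl])
    fix a
    have "{e. e \<in> {e \<in> F. g (l e) = c} \<and> l e = a} = (if c = g a then {e. e \<in> F \<and> l e = a} else {})"
      by auto
    then show "(if c = g a then 1 else 0) * (\<Sum>e | e \<in> F \<and> l e = a. \<sigma> e) =
        (\<Sum>e | e \<in> {e \<in> F. g (l e) = c} \<and> l e = a. \<sigma> e)" by simp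
  qed
  also have "\<dots> = (\<Sum>e\<in>{e \<in> F. g (l e) = c}. \<sigma> e)"
    by (rule sum.group) (use assms finA in auto)
  finally show ?thesis by simp
qed

lemma sum_lessThan_add:
  fixes f :: "nat \<Rightarrow> 'b::comm_monoid_add"
  shows "(\<Sum>j<m + n. f j) = (\<Sum>j<m. f j) + (\<Sum>j<n. f (m + j))"
  by (induction n) (simp_all add: add.assoc)

lemma relabel_toric_matrix:
  assumes "finite E" "l ` E = A" "enumerates as A"
  shows "relabel_matrix E l A u k as as' * toric_matrix E l \<sigma> as ps =
    toric_matrix E (relabeling E l A u k) \<sigma> as' ps"
proof (rule eq_matI)
  let ?R = "relabel_matrix E l A u k as as'" and ?M = "toric_matrix E l \<sigma> as ps"
    and ?N = "toric_matrix E (relabeling E l A u k) \<sigma> as' ps"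
  let ?m = "length as" and ?n = "length as'"
  have dimR: "dim_row ?R = ?n + ?n" "dim_col ?R = ?m + ?m"
    by (simp_all add: relabel_matrix_def relabel_block_def Let_def)
  have dimM: "dim_row ?M = ?m + ?m" "dim_col ?M = length ps"
    by (simp_all add: toric_matrix_def Let_def)
  have dimN: "dim_row ?N = ?n + ?n" "dim_col ?N = length ps"
    by (simp_all add: toric_matrix_def Let_def)
  show "dim_row (?R * ?M) = dim_row ?N" "dim_col (?R * ?M) = dim_col ?N"
    using dimR dimM dimN by simp_all
  fix i q assume "i < dim_row ?N" "q < dim_col ?N"
  then have i: "i < ?n + ?n" and q: "q < length ps" using dimN by auto
  let ?F = "cut E (ps ! q)"
  have F: "l ` ?F \<subseteq> A" "finite ?F" "l ` (E - ?F) \<subseteq> A" "finite (E - ?F)"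
    using assms by (auto simp: cut_def)
  have MS: "?M $$ (j, q) = (\<Sum>e | e \<in> ?F \<and> l e = as ! j. \<sigma> e)" if "j < ?m" for j
    using that q lookup_toric_image_S[OF assms(1)]
    by (simp add: toric_matrix_def Let_def nth_append)
  have MT: "?M $$ (?m + j, q) = (\<Sum>e | e \<in> E - ?F \<and> l e = as ! j. \<sigma> e)" if "j < ?m" for j
    using that q lookup_toric_image_T[OF assms(1)]
    by (simp add: toric_matrix_def Let_def nth_append)
  have "(?R * ?M) $$ (i, q) = (\<Sum>j<?m + ?m. ?R $$ (i, j) * ?M $$ (j, q))"
    using i q dimR dimM by (simp add: times_mat_def scalar_prod_def atLeast0LessThan)
  \<comment> \<open>The inner index runs first over the \<open>S\<close> rows of \<open>?M\<close>,
    then over its \<open>T\<close> rows; by the block-diagonal shape of \<open>?R\<close> only one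
    of the two sums survives for each \<open>i\<close>.\<close>
  also have "\<dots> = (\<Sum>j<?m. ?R $$ (i, j) * ?M $$ (j, q)) +
      (\<Sum>j<?m. ?R $$ (i, ?m + j) * ?M $$ (?m + j, q))"
    by (rule sum_lessThan_add)
  also have "\<dots> = ?N $$ (i, q)"
  proof (cases "i < ?n")
    case True
    have R: "?R $$ (i, j) = (if as' ! i = label_class E l A u k (as ! j) then 1 else 0)"
        "?R $$ (i, ?m + j) = 0" if "j < ?m" for j
      using that True by (simp_all add: relabel_matrix_def relabel_block_def Let_def)
    have "?N $$ (i, q) = (\<Sum>e | e \<in> ?F \<and> label_class E l A u k (l e) = as' ! i. \<sigma> e)"
      using True q by (simp add: toric_matrix_def Let_def nth_append relabeling_def
          lookup_toric_image_S[OF assms(1)])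
    then show ?thesis
      using sum_label_fibres[OF assms(3) F(1,2), of "as' ! i" "label_class E l A u k" \<sigma>]
      by (simp add: R MS)
  next
    case False
    then obtain i' where i': "i = ?n + i'" "i' < ?n"
      using i by (metis add_less_cancel_left le_add_diff_inverse not_less)
    have R: "?R $$ (i, ?m + j) = (if as' ! i' = label_class E l A u k (as ! j) then 1 else 0)"
        "?R $$ (i, j) = 0" if "j < ?m" for j
      using that i' by (simp_all add: relabel_matrix_def relabel_block_def Let_def)
    have "?N $$ (i, q) = (\<Sum>e | e \<in> E - ?F \<and> label_class E l A u k (l e) = as' ! i'. \<sigma> e)"
      using i' q by (simp add: toric_matrix_def Let_def nth_append relabeling_def
          lookup_toric_image_T[OF assms(1)])
    then show ?thesis
      using sum_label_fibres[OF assms(3) F(3,4), of "as' ! i'" "label_class E l A u k" \<sigma>]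
      by (simp add: R MT)
  qed
  finally show "(?R * ?M) $$ (i, q) = ?N $$ (i, q)" .
qed

section \<open>Matrices of the collapse: entries, finiteness, existence and column selection\<close>

lemma enumerates_length: "enumerates xs X \<Longrightarrow> length xs = card X"
  by (auto simp: enumerates_def distinct_card)

lemma index_one_append_zero:
  assumes "i < r" "j < c" "c \<le> r"
  shows "(1\<^sub>m c @\<^sub>r 0\<^sub>m (r - c) c :: int mat) $$ (i, j) = (if i = j then 1 else 0)"
  using assms by (auto simp: append_rows_def)

lemma dim_one_append_zero:
  assumes "c \<le> r"
  shows "(1\<^sub>m c @\<^sub>r 0\<^sub>m (r - c) c :: int mat) \<in> carrier_mat r c"
  using assms by (auto simp: append_rows_def)

text \<open>The equation between reordered matrices is read off entrywise, which determines the
  entries of \<open>C\<close> in the rows \<open>\<pi> i\<close>.\<close>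

lemma collapse_matrices_index:
  fixes V :: "'v set" and c r :: nat
  defines "r \<equiv> 2 ^ (card V - 1)" and "c \<equiv> 2 ^ (card V - 2)"
  assumes "C \<in> collapse_matrices V u k ps qs"
  obtains \<pi> where "C \<in> carrier_mat r c" "\<pi> permutes {..<r}" "c \<le> r"
    "\<And>i. i < c \<Longrightarrow> ps ! \<pi> i = feasible_ext u k (qs ! i)"
    "\<And>i j. i < r \<Longrightarrow> j < c \<Longrightarrow> C $$ (\<pi> i, j) = (if i = j then 1 else 0)"
proof -
  \<comment> \<open>This keeps the natural-number difference \<open>r - c\<close> from being
    truncated, so the stacked matrix really has \<open>r\<close> rows.\<close>
  have "c \<le> r" unfolding r_def c_def by (rule power_increasing) auto
  obtain \<pi> where \<pi>: "C \<in> carrier_mat r c" "\<pi> permutes {..<r}"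
    "\<forall>i<c. ps ! \<pi> i = feasible_ext u k (qs ! i)"
    and eq: "mat r c (\<lambda>(i, j). C $$ (\<pi> i, j)) = 1\<^sub>m c @\<^sub>r 0\<^sub>m (r - c) c"
    using assms(3) unfolding collapse_matrices_def Let_def r_def c_def by blast
  have "C $$ (\<pi> i, j) = (if i = j then 1 else 0)" if "i < r" "j < c" for i j
  proof -
    have "C $$ (\<pi> i, j) = mat r c (\<lambda>(i, j). C $$ (\<pi> i, j)) $$ (i, j)" using that by simp
    then show ?thesis unfolding eq index_one_append_zero[OF that \<open>c \<le> r\<close>] .
  qed
  then show ?thesis using that \<pi> \<open>c \<le> r\<close> by blast
qed

text \<open>A matrix of fixed size is given by an extensional function on its finite index set, and
  there are finitely many of these with values in \<open>B\<close>.\<close>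

lemma finite_bounded_matrices:
  assumes "finite B"
  shows "finite {C \<in> carrier_mat r c. \<forall>i<r. \<forall>j<c. C $$ (i, j) \<in> B}" (is "finite ?M")
proof -
  let ?P = "({..<r} \<times> {..<c}) \<rightarrow>\<^sub>E B"
  have "?M \<subseteq> mat r c ` ?P"
  proof
    fix C assume C: "C \<in> ?M"
    then have "C = mat r c (restrict (\<lambda>ij. C $$ ij) ({..<r} \<times> {..<c}))"
      by (intro eq_matI) auto
    moreover have "restrict (\<lambda>ij. C $$ ij) ({..<r} \<times> {..<c}) \<in> ?P" using C by auto
    ultimately show "C \<in> mat r c ` ?P" by blast
  qed
  moreover have "finite ?P" using assms by (intro finite_PiE) auto
  ultimately show ?thesis by (meson finite_imageI finite_subset)
qed

text \<open>The size depends only on \<open>card V\<close> and the entries are 0 or 1, so one finite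
  set of matrices covers all column orders at once.\<close>

lemma finite_collapse_matrices: "finite (\<Union>ps qs. collapse_matrices V u k ps qs)"
proof -
  let ?r = "2 ^ (card V - 1) :: nat" and ?c = "2 ^ (card V - 2) :: nat"
  have "(\<Union>ps qs. collapse_matrices V u k ps qs) \<subseteq>
      {C \<in> carrier_mat ?r ?c. \<forall>i<?r. \<forall>j<?c. C $$ (i, j) \<in> {0, 1}}"
  proof
    fix C assume "C \<in> (\<Union>ps qs. collapse_matrices V u k ps qs)"
    then obtain ps qs where C: "C \<in> collapse_matrices V u k ps qs" by blast
    obtain \<pi> where \<pi>: "C \<in> carrier_mat ?r ?c" "\<pi> permutes {..<?r}"
      "\<And>i j. i < ?r \<Longrightarrow> j < ?c \<Longrightarrow> C $$ (\<pi> i, j) = (if i = j then 1 else 0)"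
      by (rule collapse_matrices_index[OF C]) (rule that)
    have "C $$ (i, j) \<in> {0, 1}" if "i < ?r" "j < ?c" for i j
    proof -
      \<comment> \<open>The entries are known only in rows of the form \<open>\<pi> i'\<close>;
        surjectivity of the permutation reaches every row.\<close>
      have "i \<in> \<pi> ` {..<?r}"
        unfolding permutes_image[OF \<pi>(2)] using that(1) by (rule lessThan_iff[THEN iffD2])
      then obtain i' where "i = \<pi> i'" "i' < ?r"
        unfolding image_iff Bex_def lessThan_iff by (elim exE conjE)
      then show ?thesis using \<pi>(3)[OF _ that(2), of i'] by auto
    qed
    then show "C \<in> {C \<in> carrier_mat ?r ?c. \<forall>i<?r. \<forall>j<?c. C $$ (i, j) \<in> {0, 1}}"
      using \<pi>(1) by blast
  qed
  then show ?thesis by (rule finite_subset) (rule finite_bounded_matrices, simp)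
qed

lemma collapse_matrices_nonempty:
  assumes "finite V" "u \<in> V" "k \<in> V" "u \<noteq> k"
    "enumerates ps (partitions V)" "enumerates qs (partitions (V - {k}))"
  shows "collapse_matrices V u k ps qs \<noteq> {}"
proof -
  define r c :: nat where "r = 2 ^ (card V - 1)" and "c = 2 ^ (card V - 2)"
  have cr: "c \<le> r" unfolding r_def c_def by (rule power_increasing) auto
  have lps: "length ps = r"
    using enumerates_length[OF assms(5)] card_partitions[of V] assms by (auto simp: r_def)
  have lqs: "length qs = c"
    using enumerates_length[OF assms(6)] card_partitions_remove[OF assms(1-4)] by (simp add: c_def)
  have bij: "bij_betw (feasible_ext u k) (set qs) {p \<in> set ps. feasible u k p}"
    using feasible_ext_bij_betw[OF assms(2-4)] assms(5,6) by (simp add: enumerates_def)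
  \<comment> \<open>The required column order is \<open>?fs @ ?ns\<close>: feasible partitions in
    the order dictated by \<open>qs\<close>, then the others as they occur in
    \<open>ps\<close>.\<close>
  let ?fs = "map (feasible_ext u k) qs" and ?ns = "filter (\<lambda>p. \<not> feasible u k p) ps"
  have sf: "set ?fs = {p \<in> set ps. feasible u k p}" using bij by (simp add: bij_betw_def)
  have "distinct (?fs @ ?ns)"
    using bij assms(5,6) sf by (auto simp: enumerates_def distinct_map bij_betw_def)
  moreover have "set (?fs @ ?ns) = set ps" using sf by auto
  ultimately have "mset (?fs @ ?ns) = mset ps"
    using assms(5) by (metis enumerates_def set_eq_iff_mset_eq_distinct)
  \<comment> \<open>Entry \<open>i\<close> of the new list is \<open>ps ! \<pi> i\<close>, which is
    the direction of reordering used in \<open>collapse_matrices\<close>.\<close>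
  then obtain \<pi> where \<pi>: "\<pi> permutes {..<length ps}" "permute_list \<pi> ps = ?fs @ ?ns"
    by (rule mset_eq_permutation)
  have nth: "ps ! \<pi> i = (?fs @ ?ns) ! i" if "i < r" for i
    using permute_list_nth[OF \<pi>(1)] that lps \<pi>(2) by simp
  have ext: "ps ! \<pi> i = feasible_ext u k (qs ! i)" if "i < c" for i
    using nth[of i] that cr lqs by (simp add: nth_append)
  have feas: "feasible u k (ps ! \<pi> i) \<longleftrightarrow> i < c" if "i < r" for i
  proof (cases "i < c")
    case True
    then have "?fs ! i \<in> set ?fs" using lqs by (intro nth_mem) simp
    then have "feasible u k (?fs ! i)" unfolding sf by blast
    then show ?thesis using nth[OF that] True lqs by (simp add: nth_append)
  next
    case False
    have "length (?fs @ ?ns) = r" using \<pi>(2) lps by (metis length_permute_list)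
    then have "?ns ! (i - c) \<in> set ?ns" using False that lqs by (intro nth_mem) simp
    then have "\<not> feasible u k (?ns ! (i - c))" by simp
    then show ?thesis using nth[OF that] False lqs by (simp add: nth_append)
  qed
  \<comment> \<open>Column \<open>j\<close> is the unit vector at the position of the
    \<open>j\<close>-th feasible partition in \<open>ps\<close>; injectivity of \<open>\<pi>\<close>
    turns this into the identity over zero after reordering the rows.\<close>
  define C :: "int mat" where "C = mat r c (\<lambda>(i, j). if i = \<pi> j then 1 else 0)"
  have \<pi>r: "\<pi> permutes {..<r}" using \<pi>(1) lps by simp
  have "mat r c (\<lambda>(i, j). C $$ (\<pi> i, j)) = 1\<^sub>m c @\<^sub>r 0\<^sub>m (r - c) c"
  proof (rule eq_matI)
    fix i j
    assume "i < dim_row (1\<^sub>m c @\<^sub>r 0\<^sub>m (r - c) c :: int mat)"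
      "j < dim_col (1\<^sub>m c @\<^sub>r 0\<^sub>m (r - c) c :: int mat)"
    then have ij: "i < r" "j < c" using dim_one_append_zero[OF cr] by auto
    have "\<pi> i < r" using permutes_in_image[OF \<pi>r] ij by simp
    moreover have "\<pi> i = \<pi> j \<longleftrightarrow> i = j" using permutes_inj[OF \<pi>r] by (simp add: inj_eq)
    ultimately show "mat r c (\<lambda>(i, j). C $$ (\<pi> i, j)) $$ (i, j) =
        (1\<^sub>m c @\<^sub>r 0\<^sub>m (r - c) c) $$ (i, j)"
      unfolding index_one_append_zero[OF ij cr] using ij by (simp add: C_def)
  qed (use dim_one_append_zero[OF cr] in auto)
  moreover have "C \<in> carrier_mat r c" by (simp add: C_def)
  ultimately have "C \<in> collapse_matrices V u k ps qs"
    unfolding collapse_matrices_def Let_def r_def[symmetric] c_def[symmetric]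
    using \<pi>r feas ext by blast
  then show ?thesis by blast
qed

text \<open>Right multiplication by \<open>C\<close> selects columns: column \<open>j\<close> of the
  product is the column of the feasible extension of \<open>qs ! j\<close>, and
  \<open>toric_image_feasible_ext\<close> identifies it.\<close>

lemma toric_matrix_collapse:
  assumes "simple_graph V E" "l ` E = A" "u \<in> V" "k \<in> V" "u \<noteq> k" "{u, k} \<notin> E"
    "enumerates ps (partitions V)" "enumerates qs (partitions (V - {k}))"
    "C \<in> collapse_matrices V u k ps qs"
  shows "toric_matrix E (relabeling E l A u k) \<sigma> as' ps * C =
    toric_matrix (collapse_edges E u k) (collapse_labeling E l A u k) (collapse_mult E \<sigma> u k) as' qs"
    (is "?M * C = ?N")
proof -
  define r c :: nat where "r = 2 ^ (card V - 1)" and "c = 2 ^ (card V - 2)"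
  have fin: "finite V" using assms(1) by (simp add: simple_graph_def)
  have lps: "length ps = r"
    using enumerates_length[OF assms(7)] card_partitions[of V] assms(3) fin by (auto simp: r_def)
  have lqs: "length qs = c"
    using enumerates_length[OF assms(8)] card_partitions_remove[OF fin assms(3-5)]
    by (simp add: c_def)
  obtain \<pi> where \<pi>: "C \<in> carrier_mat r c" "\<pi> permutes {..<r}" "c \<le> r"
    "\<And>i. i < c \<Longrightarrow> ps ! \<pi> i = feasible_ext u k (qs ! i)"
    "\<And>i j. i < r \<Longrightarrow> j < c \<Longrightarrow> C $$ (\<pi> i, j) = (if i = j then 1 else 0)"
    by (rule collapse_matrices_index[OF assms(9), folded r_def c_def]) (rule that)
  show ?thesis
  proof (rule eq_matI)
    let ?m = "length as' + length as'"
    have dims: "dim_row ?M = ?m" "dim_col ?M = r" "dim_row ?N = ?m" "dim_col ?N = c"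
      by (simp_all add: toric_matrix_def Let_def lps lqs)
    show "dim_row (?M * C) = dim_row ?N" "dim_col (?M * C) = dim_col ?N"
      using dims \<pi>(1) by auto
    fix i j assume "i < dim_row ?N" "j < dim_col ?N"
    then have i: "i < ?m" and j: "j < c" using dims by auto
    have "(?M * C) $$ (i, j) = (\<Sum>q<r. ?M $$ (i, q) * C $$ (q, j))"
      using i j dims \<pi>(1) by (auto simp: times_mat_def scalar_prod_def atLeast0LessThan)
    \<comment> \<open>Reindexing along \<open>\<pi>\<close> brings the rows of \<open>C\<close> into
      the order in which its entries are those of the identity over zero.\<close>
    also have "\<dots> = (\<Sum>q<r. ?M $$ (i, \<pi> q) * C $$ (\<pi> q, j))"
      by (rule sum.reindex_bij_betw[OF permutes_imp_bij[OF \<pi>(2)], symmetric])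
    also have "\<dots> = (\<Sum>q<r. if q = j then ?M $$ (i, \<pi> q) else 0)"
      by (rule sum.cong) (use \<pi>(5) j in auto)
    also have "\<dots> = ?M $$ (i, \<pi> j)" using j \<pi>(3) by simp
    also have "\<dots> = ?N $$ (i, j)"
    proof -
      have "\<pi> j < r" using permutes_in_image[OF \<pi>(2)] j \<pi>(3) by simp
      moreover have "qs ! j \<in> partitions (V - {k})"
        using assms(8) j lqs nth_mem[of j qs] by (simp add: enumerates_def)
      note toric_image_feasible_ext[OF assms(1-6) this, of \<sigma>]
      ultimately show ?thesis
        using i j lps lqs \<pi>(4)[OF j] by (simp add: toric_matrix_def Let_def)
    qed
    finally show "(?M * C) $$ (i, j) = ?N $$ (i, j)" .
  qed
qed

theorem lemma4p3:
  fixes V :: "'v set" and E :: "'v set set" and l :: "'v set \<Rightarrow> 'a" and A :: "'a set"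
    and \<sigma> :: "'v set \<Rightarrow> int" and u k :: 'v
    and as :: "'a list" and as' :: "'a set list"
  assumes "labelled_graph V E l A \<sigma>"
    and "u \<in> V" and "k \<in> V" and "u \<noteq> k" and "{u, k} \<notin> E"
    and "singular_collapse E u k"
    and "\<forall>e\<in>collapse_edges E u k. collapse_mult E \<sigma> u k e \<noteq> 0"
    and "enumerates as A" and "enumerates as' (collapse_labels E l A u k)"
  shows
    "(\<forall>ps. enumerates ps (partitions V) \<longrightarrow>
        relabel_matrix E l A u k as as' * toric_matrix E l \<sigma> as ps =
        toric_matrix E (relabeling E l A u k) \<sigma> as' ps) \<and>
     (\<forall>ps qs. enumerates ps (partitions V) \<and> enumerates qs (partitions (V - {k})) \<longrightarrow>
        (let Cs = {C \<in> collapse_matrices V u k ps qs.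
               (relabel_matrix E l A u k as as' * toric_matrix E l \<sigma> as ps) * C =
               toric_matrix (collapse_edges E u k) (collapse_labeling E l A u k)
                 (collapse_mult E \<sigma> u k) as' qs}
         in Cs \<noteq> {} \<and> finite Cs)) \<and>
     finite {C. \<exists>ps qs. enumerates ps (partitions V) \<and> enumerates qs (partitions (V - {k})) \<and>
        C \<in> collapse_matrices V u k ps qs \<and>
        (relabel_matrix E l A u k as as' * toric_matrix E l \<sigma> as ps) * C =
        toric_matrix (collapse_edges E u k) (collapse_labeling E l A u k)
          (collapse_mult E \<sigma> u k) as' qs}"
proof -
  have G: "simple_graph V E" "l ` E = A" using assms(1) by (auto simp: labelled_graph_def)
  have finV: "finite V" using G(1) by (simp add: simple_graph_def)
  have relabel: "relabel_matrix E l A u k as as' * toric_matrix E l \<sigma> as ps =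
      toric_matrix E (relabeling E l A u k) \<sigma> as' ps" for ps
    using relabel_toric_matrix[OF simple_graph_finite_edges[OF G(1)] G(2) assms(8)] .
  note collapse = toric_matrix_collapse[OF G assms(2-5), of _ _ _ \<sigma> as']
  note fin = finite_subset[OF _ finite_collapse_matrices[of V u k]]
  show ?thesis
    unfolding relabel Let_def
  proof (intro conjI allI impI)
    fix ps qs
    assume "enumerates ps (partitions V) \<and> enumerates qs (partitions (V - {k}))"
    then show "{C \<in> collapse_matrices V u k ps qs.
        toric_matrix E (relabeling E l A u k) \<sigma> as' ps * C =
        toric_matrix (collapse_edges E u k) (collapse_labeling E l A u k)
          (collapse_mult E \<sigma> u k) as' qs} \<noteq> {}"
      \<comment> \<open>Every matrix of the collapse satisfies the equation, so the existence of one
        such matrix suffices.\<close>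
      using collapse_matrices_nonempty[OF finV assms(2-4)] collapse by blast
  \<comment> \<open>The relabeling identity has become reflexive after unfolding; both finiteness
    claims concern subsets of the finite union over all orders.\<close>
  qed (rule refl | rule fin, blast)+
qed

end
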